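(* Let $X$ and $Y$ be closure spaces and let $f,g:X\to Y$ be continuous maps. Then the following implications hold: $$f\sim_{(J_{\top},\times)}g\ \Rightarrow\ f\sim_{(J_+,\times)}g\ \Rightarrow\ f\sim_{(I_\tau,\times)}g,$$ $$f\sim_{(J_{\top},\boxplus)}g\ \Rightarrow\ f\sim_{(J_+,\boxplus)}g\ \Rightarrow\ f\sim_{(I_\tau,\boxplus)}g,$$ and, for each $J\in\{J_\top,J_+,I_\tau\}$, $$f\sim_{(J,\times)}g\ \Rightarrow\ f\sim_{(J,\boxplus)}g.$$ Furthermore, among homotopy relations obtained from an interval with $0\neq1$ and a product operation, the relation $\sim_{(J_\top,\times)}$ implies any other such homotopy relation: if $\otimes$ is any product operation and $J$ is any interval for $\otimes$ with $0_J\ne 1_J$, then $f\sim_{(J_\top,\times)}g$ implies $f\sim_{(J,\otimes)}g$.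
   Context: A (Čech) closure space $(X,c)$ is a set $X$ with a function $c:2^X\to 2^X$ such that $c(\varnothing)=\varnothing$, $A\subset c(A)$, and $c(A\cup B)=c(A)\cup c(B)$ for all $A,B\subset X$. Write $c(x)$ for $c(\{x\})$. A map $f:(X,c_X)\to(Y,c_Y)$ is continuous if $f(c_X(A))\subset c_Y(f(A))$ for all $A\subset X$. $\mathbf{Cl}$ is the category of closure spaces and continuous maps; its terminal object is the one-point space $*$. A set $U\subset X$ is a neighborhood of $x$ if $x\notin c(X\setminus U)$. Products on $X\times Y$: the product closure is $(c_X\times c_Y)(A)=\{(x,y)\mid (U\times V)\cap A\neq\varnothing$ for all neighborhoods $U$ of $x$, $V$ of $y\}$; the inductive product closure is $(c_X\boxplus c_Y)(A)=\{(x,y)\mid ((\{x\}\times V)\cup(U\times\{y\}))\cap A\neq\varnothing$ for all neighborhoods $U$ of $x$, $V$ of $y\}$. A product operation is a functor $\otimes:\mathbf{Cl}\times\mathbf{Cl}\to\mathbf{Cl}$ for which $\mathbf{Cl}$ has a symmetric monoidal structure commuting with the forgetful functor to $\mathbf{Set}$ and the cartesian symmetric monoidal structure on $\mathbf{Set}$; i.e. $(X,c_X)\otimes(Y,c_Y)=(X\times Y,c_X\otimes c_Y)$ for some closure $c_X\otimes c_Y$, the unit is $*$, and the associator, unitors and braiding are those of $\mathbf{Set}$. Both $\times$ and $\boxplus$ are product operations. An interval for $\otimes$ is a closure space $J$ with two points $0_J,1_J:*\to J$ and a symmetric, associative continuous map $\vee:J\otimes J\to J$ with $0\vee t=t$ and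 $1\vee t=1$ for all $t$. Specific intervals (for every product operation), with distinguished points $0,1$ and $\vee=\max$: $I_\tau=[0,1]$ with the closure of its standard topology; $J_\top=\{0,1\}$ with the indiscrete closure ($c(A)=\{0,1\}$ for $A\ne\varnothing$); $J_+=\{0,1\}$ with $c(0)=\{0,1\}$, $c(1)=\{1\}$. For an interval $J$ for $\otimes$ and continuous $f,g:X\to Y$, an elementary $(J,\otimes)$ homotopy from $f$ to $g$ is a continuous map $H:X\otimes J\to Y$ with $H(x,0_J)=f(x)$ and $H(x,1_J)=g(x)$ for all $x$. The relation $\sim_{(J,\otimes)}$ is the equivalence relation on the set of continuous maps $X\to Y$ generated by elementary $(J,\otimes)$ homotopies. *)

theory Defs
  imports "HOL-Analysis.Analysis"
begin

section \<open>The universe of points\<close>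

text \<open>
  A product operation is a functor on all closure spaces, so it cannot be quantified over when
  every space lives on a HOL type of its own.  All closure spaces below are therefore sets of
  elements of one type, which contains a point, the real numbers and arbitrarily many atoms and
  is closed under ordered pairs.  Every closure space on a set in \<^typ>\<open>'a\<close> has an isomorphic
  copy consisting of atoms.  The type variable is arbitrary, so the type is as large as needed.
\<close>

datatype 'a point = Star | Num real | Atom 'a | Tup (left: "'a point") (right: "'a point")

definition prod_set :: "'a point set \<Rightarrow> 'a point set \<Rightarrow> 'a point set" (infixr "\<otimes>\<^sub>S" 80)
  where "A \<otimes>\<^sub>S B = {Tup x y | x y. x \<in> A \<and> y \<in> B}"


section \<open>Closure spaces\<close>

text \<open>Only the values of \<^term>\<open>cl X A\<close> for \<^term>\<open>A \<subseteq> points X\<close> are meaningful.\<close>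

record 'p cspace =
  points :: "'p set"
  cl :: "'p set \<Rightarrow> 'p set"

definition closure_space :: "'p cspace \<Rightarrow> bool" where
  "closure_space X \<longleftrightarrow>
     (\<forall>A \<subseteq> points X. cl X A \<subseteq> points X) \<and>
     cl X {} = {} \<and>
     (\<forall>A \<subseteq> points X. A \<subseteq> cl X A) \<and>
     (\<forall>A \<subseteq> points X. \<forall>B \<subseteq> points X. cl X (A \<union> B) = cl X A \<union> cl X B)"

definition cmap :: "'p cspace \<Rightarrow> 'q cspace \<Rightarrow> ('p \<Rightarrow> 'q) \<Rightarrow> bool" where
  "cmap X Y f \<longleftrightarrow>
     f ` points X \<subseteq> points Y \<and> (\<forall>A \<subseteq> points X. f ` cl X A \<subseteq> cl Y (f ` A))"

definition ciso :: "'p cspace \<Rightarrow> 'q cspace \<Rightarrow> ('p \<Rightarrow> 'q) \<Rightarrow> bool" where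
  "ciso X Y f \<longleftrightarrow> cmap X Y f \<and>
     (\<exists>g. cmap Y X g \<and> (\<forall>x \<in> points X. g (f x) = x) \<and> (\<forall>y \<in> points Y. f (g y) = y))"

definition nbhd :: "'p cspace \<Rightarrow> 'p \<Rightarrow> 'p set \<Rightarrow> bool" where
  "nbhd X x U \<longleftrightarrow> U \<subseteq> points X \<and> x \<notin> cl X (points X - U)"

definition one_point :: "'a point cspace" where
  "one_point = \<lparr>points = {Star}, cl = (\<lambda>A. A)\<rparr>"


section \<open>Product operations\<close>

type_synonym 'a prod_op = "'a point cspace \<Rightarrow> 'a point cspace \<Rightarrow> 'a point cspace"

definition times_op :: "'a prod_op" where
  "times_op X Y = \<lparr>points = points X \<otimes>\<^sub>S points Y,
     cl = (\<lambda>A. {Tup x y | x y. x \<in> points X \<and> y \<in> points Y \<and>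
             (\<forall>U V. nbhd X x U \<and> nbhd Y y V \<longrightarrow> (U \<otimes>\<^sub>S V) \<inter> A \<noteq> {})})\<rparr>"

definition box_op :: "'a prod_op" where
  "box_op X Y = \<lparr>points = points X \<otimes>\<^sub>S points Y,
     cl = (\<lambda>A. {Tup x y | x y. x \<in> points X \<and> y \<in> points Y \<and>
             (\<forall>U V. nbhd X x U \<and> nbhd Y y V \<longrightarrow>
                (({x} \<otimes>\<^sub>S V) \<union> (U \<otimes>\<^sub>S {y})) \<inter> A \<noteq> {})})\<rparr>"

text \<open>The structure maps of the cartesian symmetric monoidal structure on sets.\<close>

definition map_tup :: "('a point \<Rightarrow> 'a point) \<Rightarrow> ('a point \<Rightarrow> 'a point) \<Rightarrow> 'a point \<Rightarrow> 'a point"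
  where "map_tup f g p = Tup (f (left p)) (g (right p))"

definition assoc_tup :: "'a point \<Rightarrow> 'a point" where
  "assoc_tup p = Tup (left (left p)) (Tup (right (left p)) (right p))"

definition swap_tup :: "'a point \<Rightarrow> 'a point" where
  "swap_tup p = Tup (right p) (left p)"

text \<open>
  On morphisms the functor has to be the cartesian product of maps, since it commutes with the
  forgetful functor.  Preservation of identities and composition, naturality and the coherence
  laws are equations between maps of sets which hold in the category of sets, so only the
  continuity of the maps involved remains to be required.
\<close>

definition product_operation :: "'a prod_op \<Rightarrow> bool" where
  "product_operation T \<longleftrightarrow>
     (\<forall>X Y. closure_space X \<and> closure_space Y \<longrightarrow>
        closure_space (T X Y) \<and> points (T X Y) = points X \<otimes>\<^sub>S points Y) \<and>
     (\<forall>X X' Y Y' f g. closure_space X \<and> closure_space X' \<and> closure_space Y \<and> closure_space Y' \<and>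
        cmap X X' f \<and> cmap Y Y' g \<longrightarrow> cmap (T X Y) (T X' Y') (map_tup f g)) \<and>
     (\<forall>X Y Z. closure_space X \<and> closure_space Y \<and> closure_space Z \<longrightarrow>
        ciso (T (T X Y) Z) (T X (T Y Z)) assoc_tup) \<and>
     (\<forall>X. closure_space X \<longrightarrow> ciso (T one_point X) X right) \<and>
     (\<forall>X. closure_space X \<longrightarrow> ciso (T X one_point) X left) \<and>
     (\<forall>X Y. closure_space X \<and> closure_space Y \<longrightarrow> ciso (T X Y) (T Y X) swap_tup)"


section \<open>Intervals\<close>

text \<open>The operation \<open>ivl_join J\<close> takes its two arguments as a \<^const>\<open>Tup\<close>.\<close>

record 'a interval =
  ivl_space :: "'a point cspace"
  ivl_zero :: "'a point"
  ivl_one :: "'a point"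
  ivl_join :: "'a point \<Rightarrow> 'a point"

definition interval_for :: "'a prod_op \<Rightarrow> 'a interval \<Rightarrow> bool" where
  "interval_for T J \<longleftrightarrow>
     closure_space (ivl_space J) \<and>
     ivl_zero J \<in> points (ivl_space J) \<and> ivl_one J \<in> points (ivl_space J) \<and>
     cmap (T (ivl_space J) (ivl_space J)) (ivl_space J) (ivl_join J) \<and>
     (\<forall>s \<in> points (ivl_space J). \<forall>t \<in> points (ivl_space J). ivl_join J (Tup s t) = ivl_join J (Tup t s)) \<and>
     (\<forall>r \<in> points (ivl_space J). \<forall>s \<in> points (ivl_space J). \<forall>t \<in> points (ivl_space J).
        ivl_join J (Tup (ivl_join J (Tup r s)) t) = ivl_join J (Tup r (ivl_join J (Tup s t)))) \<and>
     (\<forall>t \<in> points (ivl_space J). ivl_join J (Tup (ivl_zero J) t) = t) \<and>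
     (\<forall>t \<in> points (ivl_space J). ivl_join J (Tup (ivl_one J) t) = ivl_one J)"

definition num_val :: "'a point \<Rightarrow> real" where
  "num_val p = (case p of Num t \<Rightarrow> t | _ \<Rightarrow> 0)"

definition max_join :: "'a point \<Rightarrow> 'a point" where
  "max_join p = Num (max (num_val (left p)) (num_val (right p)))"

definition I_tau :: "'a interval" where
  "I_tau = \<lparr>ivl_space = \<lparr>points = Num ` {0..1},
       cl = (\<lambda>A. Num ` (top_of_set {0..1} closure_of (Num -` A)))\<rparr>,
     ivl_zero = Num 0, ivl_one = Num 1, ivl_join = max_join\<rparr>"

definition J_top :: "'a interval" where
  "J_top = \<lparr>ivl_space = \<lparr>points = {Num 0, Num 1},
       cl = (\<lambda>A. if A = {} then {} else {Num 0, Num 1})\<rparr>,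
     ivl_zero = Num 0, ivl_one = Num 1, ivl_join = max_join\<rparr>"

text \<open>The closure operation determined by c(0) = {0,1} and c(1) = {1}, using additivity.\<close>

definition J_plus :: "'a interval" where
  "J_plus = \<lparr>ivl_space = \<lparr>points = {Num 0, Num 1},
       cl = (\<lambda>A. if Num 0 \<in> A then {Num 0, Num 1} else A)\<rparr>,
     ivl_zero = Num 0, ivl_one = Num 1, ivl_join = max_join\<rparr>"


section \<open>Homotopy\<close>

definition elementary_homotopy ::
  "'a prod_op \<Rightarrow> 'a interval \<Rightarrow> 'a point cspace \<Rightarrow> 'a point cspace \<Rightarrow>
   ('a point \<Rightarrow> 'a point) \<Rightarrow> ('a point \<Rightarrow> 'a point) \<Rightarrow> ('a point \<Rightarrow> 'a point) \<Rightarrow> bool" where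
  "elementary_homotopy T J X Y f g H \<longleftrightarrow>
     cmap (T X (ivl_space J)) Y H \<and>
     (\<forall>x \<in> points X. H (Tup x (ivl_zero J)) = f x \<and> H (Tup x (ivl_one J)) = g x)"

text \<open>
  Continuous maps are represented by functions on the whole type.  Two functions which agree on
  \<^term>\<open>points X\<close> are related by a constant elementary homotopy, so the relation does not depend on
  the values outside \<^term>\<open>points X\<close>.
\<close>

definition homotopic ::
  "'a prod_op \<Rightarrow> 'a interval \<Rightarrow> 'a point cspace \<Rightarrow> 'a point cspace \<Rightarrow>
   ('a point \<Rightarrow> 'a point) \<Rightarrow> ('a point \<Rightarrow> 'a point) \<Rightarrow> bool" where
  "homotopic T J X Y =
     equivclp (\<lambda>f g. cmap X Y f \<and> cmap X Y g \<and> (\<exists>H. elementary_homotopy T J X Y f g H))"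

end

theory Submission
  imports Defs
begin

text \<open>
  Precomposing homotopies with a map \<open>X \<otimes>' J' \<rightarrow> X \<otimes> J\<close> of the form \<open>(x, t) \<mapsto> (x, \<phi> t)\<close>, where \<open>\<phi>\<close>
  preserves the endpoints, shows that \<open>(J, \<otimes>)\<close> homotopy implies \<open>(J', \<otimes>')\<close> homotopy.  The map from
  \<open>I\<^sub>\<tau>\<close> to \<open>J\<^sub>+\<close> sends \<open>1\<close> to \<open>1\<close> and everything else to \<open>0\<close>; into \<open>J\<^sub>\<top>\<close> every function is continuous.
  The product \<open>\<times>\<close> is the categorical product, and the projections of any product operation are
  continuous since they factor through the unitors, so the identity from \<open>X \<otimes> Y\<close> to \<open>X \<times> Y\<close> is
  continuous.
\<close>

section \<open>Closures, continuous maps and neighborhoods\<close>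

lemma closure_space_mono:
  assumes "closure_space X" "A \<subseteq> B" "B \<subseteq> points X"
  shows "cl X A \<subseteq> cl X B"
proof -
  have "A \<subseteq> points X" and B: "B = A \<union> B"
    using assms by auto
  then have "cl X (A \<union> B) = cl X A \<union> cl X B"
    using assms unfolding closure_space_def by blast
  with B show ?thesis by auto
qed

lemma cmap_points: "cmap X Y f \<Longrightarrow> x \<in> points X \<Longrightarrow> f x \<in> points Y"
  by (auto simp: cmap_def)

lemma cmap_compose:
  assumes "cmap X Y f" "cmap Y Z g"
  shows "cmap X Z (\<lambda>x. g (f x))"
  unfolding cmap_def
proof (intro conjI allI impI)
  show "(\<lambda>x. g (f x)) ` points X \<subseteq> points Z"
    using assms by (auto intro: cmap_points)
  fix A assume A: "A \<subseteq> points X"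
  then have "f ` cl X A \<subseteq> cl Y (f ` A)" and fA: "f ` A \<subseteq> points Y"
    using assms(1) by (auto simp: cmap_def)
  moreover have "g ` cl Y (f ` A) \<subseteq> cl Z (g ` f ` A)"
    using assms(2) fA by (auto simp: cmap_def)
  ultimately show "(\<lambda>x. g (f x)) ` cl X A \<subseteq> cl Z ((\<lambda>x. g (f x)) ` A)"
    unfolding image_image[symmetric, of g f] by (meson image_mono order_trans)
qed

lemma cmap_ident: "cmap X X (\<lambda>x. x)"
  by (simp add: cmap_def)

lemma cmap_one_point:
  assumes "closure_space X"
  shows "cmap X one_point (\<lambda>_. Star)"
proof -
  \<comment> \<open>A nonempty \<open>A\<close> already has image \<open>{Star}\<close>; for
    \<open>A = {}\<close> the axiom that the closure of the empty set is empty decides.\<close>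
  have "(\<lambda>_. Star) ` cl X A \<subseteq> (\<lambda>_. Star) ` A" for A
    using assms by (cases "A = {}") (simp_all add: closure_space_def image_constant_conv)
  then show ?thesis
    unfolding cmap_def one_point_def by auto
qed

lemma nbhd_mem:
  assumes "closure_space X" "x \<in> points X" "nbhd X x U"
  shows "x \<in> U"
proof -
  have "points X - U \<subseteq> cl X (points X - U)"
    using assms(1) unfolding closure_space_def by blast
  then show ?thesis using assms unfolding nbhd_def by blast
qed

lemma nbhd_points: "closure_space X \<Longrightarrow> nbhd X x (points X)"
  by (simp add: nbhd_def closure_space_def)

text \<open>De Morgan turns the complement of the intersection into a union, to which additivity of
  the closure applies.\<close>

lemma nbhd_Int:
  assumes "closure_space X" "nbhd X x U" "nbhd X x V"
  shows "nbhd X x (U \<inter> V)"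
proof -
  have "cl X ((points X - U) \<union> (points X - V)) = cl X (points X - U) \<union> cl X (points X - V)"
    using assms(1) by (simp add: closure_space_def)
  then show ?thesis
    using assms(2,3) by (auto simp: nbhd_def Diff_Int)
qed

lemma cl_meets_nbhd:
  assumes "closure_space X" "A \<subseteq> points X" "x \<in> cl X A" "nbhd X x U"
  shows "U \<inter> A \<noteq> {}"
proof
  assume "U \<inter> A = {}"
  then have "cl X A \<subseteq> cl X (points X - U)"
    using assms(1,2) by (intro closure_space_mono) auto
  then show False using assms(3,4) unfolding nbhd_def by blast
qed

text \<open>Converse of \<open>cl_meets_nbhd\<close>: the complement of \<open>A\<close> is a
  neighborhood of \<open>x\<close> that misses \<open>A\<close>. It supplies the neighborhood that
  refutes \<open>x\<close> being adherent when the projections are treated.\<close>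

lemma nbhd_compl:
  assumes "A \<subseteq> points X" "x \<notin> cl X A"
  shows "nbhd X x (points X - A)"
  using assms by (simp add: nbhd_def double_diff)

text \<open>\<open>f\<close> sends the complement of the preimage into the complement of
  \<open>V\<close>. If \<open>x\<close> were in the closure of the former, continuity and
  monotonicity would put \<open>f x\<close> in the closure of the latter.\<close>

lemma nbhd_vimage:
  assumes "cmap X Y f" "closure_space Y" "x \<in> points X" "nbhd Y (f x) V"
  shows "nbhd X x {a \<in> points X. f a \<in> V}"
proof -
  let ?A = "points X - {a \<in> points X. f a \<in> V}"
  have "f ` cl X ?A \<subseteq> cl Y (f ` ?A)"
    using assms(1) unfolding cmap_def by (meson Diff_subset)
  also have "\<dots> \<subseteq> cl Y (points Y - V)"
    using assms(1,2) by (intro closure_space_mono) (auto simp: cmap_def)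
  finally show ?thesis using assms(4) unfolding nbhd_def by blast
qed

lemma cl_subset_points: "closure_space X \<Longrightarrow> A \<subseteq> points X \<Longrightarrow> cl X A \<subseteq> points X"
  by (simp add: closure_space_def)

section \<open>Universal property of the product \<open>times_op\<close>\<close>

lemma cmap_into_times:
  assumes "closure_space Z" "closure_space X" "closure_space Y"
    and "cmap Z X p" "cmap Z Y q"
  shows "cmap Z (times_op X Y) (\<lambda>z. Tup (p z) (q z))"
  unfolding cmap_def
proof (intro conjI allI impI)
  show "(\<lambda>z. Tup (p z) (q z)) ` points Z \<subseteq> points (times_op X Y)"
    using assms(4,5) by (auto simp: times_op_def prod_set_def intro: cmap_points)
  fix A assume A: "A \<subseteq> points Z"
  show "(\<lambda>z. Tup (p z) (q z)) ` cl Z A \<subseteq> cl (times_op X Y) ((\<lambda>z. Tup (p z) (q z)) ` A)"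
  proof (rule image_subsetI)
    fix z assume z: "z \<in> cl Z A"
    then have zZ: "z \<in> points Z" using cl_subset_points[OF assms(1) A] by blast
    have "(U \<otimes>\<^sub>S V) \<inter> (\<lambda>z. Tup (p z) (q z)) ` A \<noteq> {}"
      if "nbhd X (p z) U" "nbhd Y (q z) V" for U V
    proof -
      \<comment> \<open>The preimages of \<open>U\<close> and \<open>V\<close> are neighborhoods of
        \<open>z\<close>, so their intersection is one too and meets \<open>A\<close>; a common
        point is sent into the rectangle.\<close>
      have "nbhd Z z ({a \<in> points Z. p a \<in> U} \<inter> {a \<in> points Z. q a \<in> V})"
        using that assms zZ by (intro nbhd_Int nbhd_vimage) auto
      from cl_meets_nbhd[OF assms(1) A z this]
      obtain a where "a \<in> A" "p a \<in> U" "q a \<in> V" by blast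
      then show ?thesis by (auto simp: prod_set_def)
    qed
    then show "Tup (p z) (q z) \<in> cl (times_op X Y) ((\<lambda>z. Tup (p z) (q z)) ` A)"
      using zZ assms(4,5) by (auto simp: times_op_def intro: cmap_points)
  qed
qed

lemma closure_space_times:
  assumes "closure_space X" "closure_space Y"
  shows "closure_space (times_op X Y)"
proof -
  let ?P = "\<lambda>x y A. \<forall>U V. nbhd X x U \<and> nbhd Y y V \<longrightarrow> (U \<otimes>\<^sub>S V) \<inter> A \<noteq> {}"
  have cl: "cl (times_op X Y) A = {Tup x y | x y. x \<in> points X \<and> y \<in> points Y \<and> ?P x y A}" for A
    by (simp add: times_op_def)
  \<comment> \<open>Additivity: if one rectangle around the point misses \<open>A\<close> and
    another misses \<open>B\<close>, the rectangle of the intersected sides misses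
    \<open>A \<union> B\<close>.\<close>
  have union: "?P x y (A \<union> B) \<longleftrightarrow> ?P x y A \<or> ?P x y B" for x y A B
  proof
    assume H: "?P x y (A \<union> B)"
    show "?P x y A \<or> ?P x y B"
    proof (rule ccontr)
      assume "\<not> ?thesis"
      then obtain U V U' V' where *: "nbhd X x U" "nbhd Y y V" "(U \<otimes>\<^sub>S V) \<inter> A = {}"
        "nbhd X x U'" "nbhd Y y V'" "(U' \<otimes>\<^sub>S V') \<inter> B = {}"
        by blast
      then have "nbhd X x (U \<inter> U')" "nbhd Y y (V \<inter> V')"
        by (simp_all add: assms nbhd_Int)
      with H have "((U \<inter> U') \<otimes>\<^sub>S (V \<inter> V')) \<inter> (A \<union> B) \<noteq> {}" by blast
      moreover have "(U \<inter> U') \<otimes>\<^sub>S (V \<inter> V') \<subseteq> (U \<otimes>\<^sub>S V) \<inter> (U' \<otimes>\<^sub>S V')"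
        by (auto simp: prod_set_def)
      ultimately show False using * by blast
    qed
  qed blast
  have *: "Tup x y \<in> U \<otimes>\<^sub>S V"
    if "x \<in> points X" "y \<in> points Y" "nbhd X x U" "nbhd Y y V" for x y U V
    using nbhd_mem[OF assms(1) that(1,3)] nbhd_mem[OF assms(2) that(2,4)]
    by (simp add: prod_set_def)
  have "A \<subseteq> cl (times_op X Y) A" if "A \<subseteq> points (times_op X Y)" for A
  proof
    fix z assume z: "z \<in> A"
    with that obtain x y where "z = Tup x y" "x \<in> points X" "y \<in> points Y"
      by (auto simp: times_op_def prod_set_def)
    with z * show "z \<in> cl (times_op X Y) A"
      unfolding cl by blast
  qed
  moreover have "cl (times_op X Y) A \<subseteq> points (times_op X Y)" for A
    unfolding cl by (auto simp: times_op_def prod_set_def)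
  \<comment> \<open>The condition fails for the empty set because each point has at least one
    neighborhood, the whole space.\<close>
  moreover have "cl (times_op X Y) {} = {}"
    unfolding cl using nbhd_points[OF assms(1)] nbhd_points[OF assms(2)] by auto
  moreover have "cl (times_op X Y) (A \<union> B) = cl (times_op X Y) A \<union> cl (times_op X Y) B" for A B
    unfolding cl union by blast
  ultimately show ?thesis by (simp add: closure_space_def)
qed

lemma cmap_left_times:
  assumes "closure_space X" "closure_space Y"
  shows "cmap (times_op X Y) X left"
  unfolding cmap_def
proof (intro conjI allI impI)
  show "left ` points (times_op X Y) \<subseteq> points X"
    by (auto simp: times_op_def prod_set_def)
  fix A assume A: "A \<subseteq> points (times_op X Y)"
  then have lA: "left ` A \<subseteq> points X" by (auto simp: times_op_def prod_set_def)
  show "left ` cl (times_op X Y) A \<subseteq> cl X (left ` A)"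
  proof (clarsimp simp: times_op_def)
    fix x y assume x: "x \<in> points X"
      and H: "\<forall>U V. nbhd X x U \<and> nbhd Y y V \<longrightarrow> (U \<otimes>\<^sub>S V) \<inter> A \<noteq> {}"
    show "x \<in> cl X (left ` A)"
    proof (rule ccontr)
      assume "x \<notin> cl X (left ` A)"
      \<comment> \<open>The rectangle over the complement of the shadow \<open>left\<close> followed
        by all of \<open>Y\<close> in the second direction cannot meet \<open>A\<close>.\<close>
      from H nbhd_compl[OF lA this] nbhd_points[OF assms(2)]
      have "((points X - left ` A) \<otimes>\<^sub>S points Y) \<inter> A \<noteq> {}" by blast
      then show False by (force simp: prod_set_def)
    qed
  qed
qed

lemma cmap_right_times:
  assumes "closure_space X" "closure_space Y"
  shows "cmap (times_op X Y) Y right"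
  unfolding cmap_def
proof (intro conjI allI impI)
  show "right ` points (times_op X Y) \<subseteq> points Y"
    by (auto simp: times_op_def prod_set_def)
  fix A assume A: "A \<subseteq> points (times_op X Y)"
  then have rA: "right ` A \<subseteq> points Y" by (auto simp: times_op_def prod_set_def)
  show "right ` cl (times_op X Y) A \<subseteq> cl Y (right ` A)"
  proof (clarsimp simp: times_op_def)
    fix x y assume y: "y \<in> points Y"
      and H: "\<forall>U V. nbhd X x U \<and> nbhd Y y V \<longrightarrow> (U \<otimes>\<^sub>S V) \<inter> A \<noteq> {}"
    show "y \<in> cl Y (right ` A)"
    proof (rule ccontr)
      assume "y \<notin> cl Y (right ` A)"
      from H nbhd_compl[OF rA this] nbhd_points[OF assms(1)]
      have "(points X \<otimes>\<^sub>S (points Y - right ` A)) \<inter> A \<noteq> {}" by blast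
      then show False by (force simp: prod_set_def)
    qed
  qed
qed

text \<open>Each component is a projection followed by a continuous map, so the universal property
  gives functoriality.\<close>

lemma cmap_times_map_tup:
  assumes "closure_space X" "closure_space Y" "closure_space X'" "closure_space Y'"
    and "cmap X X' f" "cmap Y Y' g"
  shows "cmap (times_op X Y) (times_op X' Y') (map_tup f g)"
  using cmap_into_times[OF closure_space_times[OF assms(1,2)] assms(3,4)
      cmap_compose[OF cmap_left_times[OF assms(1,2)] assms(5)]
      cmap_compose[OF cmap_right_times[OF assms(1,2)] assms(6)]]
  by (simp add: map_tup_def[abs_def])

section \<open>The inductive product: functoriality and comparison with
  \<open>times_op\<close>\<close>

lemma cmap_box_map_tup:
  assumes "closure_space X'" "closure_space Y'" "cmap X X' f" "cmap Y Y' g"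
  shows "cmap (box_op X Y) (box_op X' Y') (map_tup f g)"
  unfolding cmap_def
proof (intro conjI allI impI)
  show "map_tup f g ` points (box_op X Y) \<subseteq> points (box_op X' Y')"
    using assms(3,4) by (auto simp: box_op_def prod_set_def map_tup_def intro: cmap_points)
  fix A assume "A \<subseteq> points (box_op X Y)"
  show "map_tup f g ` cl (box_op X Y) A \<subseteq> cl (box_op X' Y') (map_tup f g ` A)"
  proof (rule image_subsetI)
    fix z assume "z \<in> cl (box_op X Y) A"
    then obtain x y where z: "z = Tup x y" "x \<in> points X" "y \<in> points Y"
      and H: "\<And>U V. nbhd X x U \<Longrightarrow> nbhd Y y V \<Longrightarrow> (({x} \<otimes>\<^sub>S V) \<union> (U \<otimes>\<^sub>S {y})) \<inter> A \<noteq> {}"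
      by (auto simp: box_op_def)
    \<comment> \<open>Pulling back \<open>U\<close> along \<open>f\<close> and \<open>V\<close>
      along \<open>g\<close> gives a cross centred at \<open>(x, y)\<close>;
      \<open>map_tup f g\<close> carries its vertical and horizontal arms into those of the cross
      centred at \<open>(f x, g y)\<close>.\<close>
    have "(({f x} \<otimes>\<^sub>S V) \<union> (U \<otimes>\<^sub>S {g y})) \<inter> map_tup f g ` A \<noteq> {}"
      if "nbhd X' (f x) U" "nbhd Y' (g y) V" for U V
    proof -
      from H[OF nbhd_vimage[OF assms(3,1) z(2) that(1)] nbhd_vimage[OF assms(4,2) z(3) that(2)]]
      obtain a where "a \<in> A"
        "a \<in> ({x} \<otimes>\<^sub>S {b \<in> points Y. g b \<in> V}) \<union> ({b \<in> points X. f b \<in> U} \<otimes>\<^sub>S {y})"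
        by blast
      then have "map_tup f g a \<in> (({f x} \<otimes>\<^sub>S V) \<union> (U \<otimes>\<^sub>S {g y})) \<inter> map_tup f g ` A"
        by (auto simp: prod_set_def map_tup_def)
      then show ?thesis by blast
    qed
    then show "map_tup f g z \<in> cl (box_op X' Y') (map_tup f g ` A)"
      using z assms(3,4) by (auto simp: box_op_def map_tup_def intro: cmap_points)
  qed
qed

text \<open>Neighborhoods contain their point, so the cross lies inside the rectangle and meeting
  the cross is the stronger condition. The identity is written with \<open>map_tup\<close> to fit
  \<open>homotopic_reparametrize\<close>.\<close>

lemma cmap_box_times:
  assumes "closure_space X" "closure_space Y"
  shows "cmap (box_op X Y) (times_op X Y) (map_tup (\<lambda>x. x) (\<lambda>y. y))"
proof -
  \<comment> \<open>This \<open>map_tup\<close> rebuilds pairs, so it acts as the identity on sets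
    of pairs but not on arbitrary elements of the type.\<close>
  have "map_tup (\<lambda>x. x) (\<lambda>y. y) ` A = A" if "A \<subseteq> points X \<otimes>\<^sub>S points Y" for A
    using that by (force simp: prod_set_def map_tup_def image_iff)
  moreover have "cl (box_op X Y) A \<subseteq> cl (times_op X Y) A" for A
  proof
    fix z assume "z \<in> cl (box_op X Y) A"
    then obtain x y where z: "z = Tup x y" "x \<in> points X" "y \<in> points Y"
      and H: "\<And>U V. nbhd X x U \<Longrightarrow> nbhd Y y V \<Longrightarrow> (({x} \<otimes>\<^sub>S V) \<union> (U \<otimes>\<^sub>S {y})) \<inter> A \<noteq> {}"
      by (auto simp: box_op_def)
    have "(U \<otimes>\<^sub>S V) \<inter> A \<noteq> {}" if UV: "nbhd X x U" "nbhd Y y V" for U V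
    proof -
      have "({x} \<otimes>\<^sub>S V) \<union> (U \<otimes>\<^sub>S {y}) \<subseteq> U \<otimes>\<^sub>S V"
        using nbhd_mem[OF assms(1) z(2) UV(1)] nbhd_mem[OF assms(2) z(3) UV(2)]
        by (auto simp: prod_set_def)
      then show ?thesis using H[OF UV] by blast
    qed
    then show "z \<in> cl (times_op X Y) A" using z by (auto simp: times_op_def)
  qed
  moreover have "cl (box_op X Y) A \<subseteq> points X \<otimes>\<^sub>S points Y" for A
    by (auto simp: box_op_def prod_set_def)
  moreover have "points (box_op X Y) = points X \<otimes>\<^sub>S points Y"
    "points (times_op X Y) = points X \<otimes>\<^sub>S points Y"
    by (simp_all add: box_op_def times_op_def)
  ultimately show ?thesis by (simp add: cmap_def)
qed

section \<open>Projections of an arbitrary product operation\<close>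

lemma product_operation_map_tup:
  assumes "product_operation T"
    and "closure_space X" "closure_space X'" "closure_space Y" "closure_space Y'"
    and "cmap X X' f" "cmap Y Y' g"
  shows "cmap (T X Y) (T X' Y') (map_tup f g)"
  using conjunct1[OF conjunct2[OF assms(1)[unfolded product_operation_def]]] assms(2-) by simp

text \<open>Functoriality collapses the second factor to the one-point space; the right unitor then
  reads off the first coordinate.\<close>

lemma product_operation_left:
  assumes "product_operation T" "closure_space X" "closure_space Y"
  shows "cmap (T X Y) X left"
proof -
  have one: "closure_space one_point"
    by (simp add: closure_space_def one_point_def)
  have "cmap (T X Y) (T X one_point) (map_tup (\<lambda>x. x) (\<lambda>_. Star))"
    by (intro product_operation_map_tup assms one cmap_ident cmap_one_point)
  moreover have "cmap (T X one_point) X left"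
    using assms by (simp add: product_operation_def ciso_def)
  ultimately have "cmap (T X Y) X (\<lambda>z. left (map_tup (\<lambda>x. x) (\<lambda>_. Star) z))"
    by (rule cmap_compose)
  then show ?thesis by (simp add: map_tup_def)
qed

lemma product_operation_right:
  assumes "product_operation T" "closure_space X" "closure_space Y"
  shows "cmap (T X Y) Y right"
proof -
  have one: "closure_space one_point"
    by (simp add: closure_space_def one_point_def)
  have "cmap (T X Y) (T one_point Y) (map_tup (\<lambda>_. Star) (\<lambda>x. x))"
    by (intro product_operation_map_tup assms one cmap_ident cmap_one_point)
  moreover have "cmap (T one_point Y) Y right"
    using assms by (simp add: product_operation_def ciso_def)
  ultimately have "cmap (T X Y) Y (\<lambda>z. right (map_tup (\<lambda>_. Star) (\<lambda>x. x) z))"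
    by (rule cmap_compose)
  then show ?thesis by (simp add: map_tup_def)
qed

section \<open>The three intervals and the maps between them\<close>

lemma closure_space_J_top: "closure_space (ivl_space J_top)"
  by (auto simp: closure_space_def J_top_def)

lemma closure_space_J_plus: "closure_space (ivl_space J_plus)"
  by (auto simp: closure_space_def J_plus_def)

lemma closure_space_I_tau: "closure_space (ivl_space I_tau)"
proof -
  let ?T = "top_of_set {0..1::real}"
  have "A \<subseteq> Num ` (?T closure_of (Num -` A))" if A: "A \<subseteq> Num ` {0..1}" for A :: "'a point set"
  proof -
    have "Num -` A \<subseteq> ?T closure_of (Num -` A)"
      using A by (intro closure_of_subset) auto
    then show ?thesis using A by blast
  qed
  moreover have "?T closure_of S \<subseteq> {0..1}" for S
    using closure_of_subset_topspace[of ?T S] by simp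
  ultimately show ?thesis
    by (simp add: closure_space_def I_tau_def vimage_Un closure_of_Un image_Un image_mono)
qed

lemma cmap_into_J_top:
  assumes "closure_space X" "\<phi> ` points X \<subseteq> {Num 0, Num 1}"
  shows "cmap X (ivl_space J_top) \<phi>"
  unfolding cmap_def
proof (intro conjI allI impI)
  show "\<phi> ` points X \<subseteq> points (ivl_space J_top)"
    using assms(2) by (simp add: J_top_def)
  fix A assume "A \<subseteq> points X"
  then have "\<phi> ` cl X A \<subseteq> {Num 0, Num 1}"
    using assms(2) cl_subset_points[OF assms(1)] by blast
  moreover have "cl X {} = {}"
    using assms(1) by (simp add: closure_space_def)
  ultimately show "\<phi> ` cl X A \<subseteq> cl (ivl_space J_top) (\<phi> ` A)"
    by (cases "A = {}") (simp_all add: J_top_def)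
qed

lemma cmap_I_tau_J_plus:
  "cmap (ivl_space I_tau) (ivl_space J_plus) (\<lambda>p. if p = Num 1 then Num 1 else Num 0)"
  (is "cmap _ _ ?\<phi>")
  unfolding cmap_def
proof (intro conjI allI impI)
  show "?\<phi> ` points (ivl_space I_tau) \<subseteq> points (ivl_space J_plus)"
    by (auto simp: J_plus_def)
  fix A :: "'a point set" assume A: "A \<subseteq> points (ivl_space I_tau)"
  show "?\<phi> ` cl (ivl_space I_tau) A \<subseteq> cl (ivl_space J_plus) (?\<phi> ` A)"
  \<comment> \<open>Subsets of \<open>{Num 1}\<close> are closed in the unit interval, since
    \<open>{1}\<close> is. Any other \<open>A\<close> has \<open>Num 0\<close> in its image, and the
    closure of that image is all of \<open>J_plus\<close>.\<close>
  proof (cases "A \<subseteq> {Num 1}")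
    case True
    then have "A = {} \<or> A = {Num 1}" by blast
    moreover have "Num -` {Num 1 :: 'a point} = {1}" by auto
    moreover have "top_of_set {0..1} closure_of {1::real} = {1}"
      by (subst closure_of_subtopology) auto
    ultimately have "cl (ivl_space I_tau) A = A"
      by (auto simp: I_tau_def)
    then show ?thesis by (auto simp: J_plus_def)
  next
    case False
    then have "Num 0 \<in> ?\<phi> ` A" by (force simp: image_iff)
    then show ?thesis by (auto simp: J_plus_def)
  qed
qed

section \<open>Transfer of homotopies along reparametrizations\<close>

lemma equivclp_mono: "r \<le> s \<Longrightarrow> equivclp r \<le> equivclp s"
  unfolding equivclp_def symclp_pointfree
  by (intro rtranclp_mono sup_mono) simp_all

lemma homotopic_reparametrize:
  assumes "homotopic T J X Y f g"
    and "cmap (T' X (ivl_space J')) (T X (ivl_space J)) (map_tup (\<lambda>x. x) \<phi>)"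
    and "\<phi> (ivl_zero J') = ivl_zero J" "\<phi> (ivl_one J') = ivl_one J"
  shows "homotopic T' J' X Y f g"
proof -
  \<comment> \<open>Stated for all \<open>f\<close> and \<open>g\<close>, because a chain of
    elementary homotopies passes through intermediate maps. Its steps keep their end maps, so
    monotonicity of the generated equivalence finishes.\<close>
  have "elementary_homotopy T' J' X Y f g (\<lambda>z. H (map_tup (\<lambda>x. x) \<phi> z))"
    if "elementary_homotopy T J X Y f g H" for f g H
    using that assms(3,4) cmap_compose[OF assms(2), of Y H]
    by (simp add: elementary_homotopy_def map_tup_def)
  then have "(\<lambda>f g. cmap X Y f \<and> cmap X Y g \<and> (\<exists>H. elementary_homotopy T J X Y f g H))
      \<le> (\<lambda>f g. cmap X Y f \<and> cmap X Y g \<and> (\<exists>H. elementary_homotopy T' J' X Y f g H))"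
    by blast
  from equivclp_mono[OF this] show ?thesis
    using assms(1) unfolding homotopic_def by (simp add: le_fun_def)
qed

theorem theorem4p36:
  fixes X Y :: "'a point cspace" and f g :: "'a point \<Rightarrow> 'a point"
  assumes "closure_space X" and "closure_space Y"
    and "cmap X Y f" and "cmap X Y g"
  shows "((homotopic times_op J_top X Y f g \<longrightarrow> homotopic times_op J_plus X Y f g) \<and>
          (homotopic times_op J_plus X Y f g \<longrightarrow> homotopic times_op I_tau X Y f g)) \<and>
         ((homotopic box_op J_top X Y f g \<longrightarrow> homotopic box_op J_plus X Y f g) \<and>
          (homotopic box_op J_plus X Y f g \<longrightarrow> homotopic box_op I_tau X Y f g)) \<and>
         (\<forall>J \<in> {J_top, J_plus, I_tau}.
            homotopic times_op J X Y f g \<longrightarrow> homotopic box_op J X Y f g) \<and>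
         (\<forall>T J. product_operation T \<and> interval_for T J \<and> ivl_zero J \<noteq> ivl_one J \<longrightarrow>
            homotopic times_op J_top X Y f g \<longrightarrow> homotopic T J X Y f g)"
proof -
  \<comment> \<open>Both two-point intervals have the same points, so the reparametrization is the
    identity; it is continuous because its target is indiscrete.\<close>
  have top_plus: "cmap (ivl_space J_plus) (ivl_space J_top) (\<lambda>t::'a point. t)"
    by (intro cmap_into_J_top closure_space_J_plus) (auto simp: J_plus_def)
  have "homotopic times_op J_plus X Y f g" if "homotopic times_op J_top X Y f g"
    by (rule homotopic_reparametrize[OF that],
        rule cmap_times_map_tup[OF assms(1) closure_space_J_plus assms(1) closure_space_J_top cmap_ident top_plus])
      (simp_all add: J_top_def J_plus_def)
  moreover have "homotopic times_op I_tau X Y f g" if "homotopic times_op J_plus X Y f g"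
    by (rule homotopic_reparametrize[OF that],
        rule cmap_times_map_tup[OF assms(1) closure_space_I_tau assms(1) closure_space_J_plus cmap_ident cmap_I_tau_J_plus])
      (simp_all add: J_plus_def I_tau_def)
  moreover have "homotopic box_op J_plus X Y f g" if "homotopic box_op J_top X Y f g"
    by (rule homotopic_reparametrize[OF that],
        rule cmap_box_map_tup[OF assms(1) closure_space_J_top cmap_ident top_plus])
      (simp_all add: J_top_def J_plus_def)
  moreover have "homotopic box_op I_tau X Y f g" if "homotopic box_op J_plus X Y f g"
    by (rule homotopic_reparametrize[OF that],
        rule cmap_box_map_tup[OF assms(1) closure_space_J_plus cmap_ident cmap_I_tau_J_plus])
      (simp_all add: J_plus_def I_tau_def)
  moreover have "homotopic box_op J X Y f g"
    if J: "J \<in> {J_top, J_plus, I_tau}" and "homotopic times_op J X Y f g" for J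
  proof -
    have csJ: "closure_space (ivl_space J)"
      using J closure_space_J_top closure_space_J_plus closure_space_I_tau by blast
    show ?thesis
      by (rule homotopic_reparametrize[OF that(2)], rule cmap_box_times[OF assms(1) csJ]) simp_all
  qed
  moreover have "homotopic T J X Y f g"
    if T: "product_operation T" and J: "interval_for T J" and ne: "ivl_zero J \<noteq> ivl_one J"
      and H: "homotopic times_op J_top X Y f g" for T J
  proof -
    \<comment> \<open>The characteristic function of the point \<open>ivl_one J\<close>. The
      assumption \<open>ne\<close> ensures that it sends \<open>ivl_zero J\<close> to
      \<open>Num 0\<close>.\<close>
    let ?\<phi> = "\<lambda>t. if t = ivl_one J then Num 1 else Num 0 :: 'a point"
    have csJ: "closure_space (ivl_space J)"
      using J by (simp add: interval_for_def)
    have "closure_space (T X (ivl_space J))"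
      using T assms(1) csJ by (simp add: product_operation_def)
    moreover have "cmap (ivl_space J) (ivl_space J_top) ?\<phi>"
      by (rule cmap_into_J_top[OF csJ]) auto
    \<comment> \<open>By the universal property of \<open>times_op\<close>, it suffices that the two
      components are continuous: the left projection of \<open>T\<close>, and its right projection
      followed by the map into \<open>J_top\<close>.\<close>
    ultimately have "cmap (T X (ivl_space J)) (times_op X (ivl_space J_top))
        (\<lambda>z. Tup (left z) (?\<phi> (right z)))"
      by (intro cmap_into_times assms(1) closure_space_J_top product_operation_left[OF T _ csJ]
          cmap_compose[OF product_operation_right[OF T assms(1) csJ]])
    then have "cmap (T X (ivl_space J)) (times_op X (ivl_space J_top)) (map_tup (\<lambda>x. x) ?\<phi>)"
      by (simp add: map_tup_def[abs_def])
    then show ?thesis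
      by (rule homotopic_reparametrize[OF H]) (use ne in \<open>simp_all add: J_top_def\<close>)
  qed
  ultimately show ?thesis by blast
qed

end
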